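(* Let $A$ be a real symmetric $n\times n$ matrix with eigenvalues $\lambda_1,\dots,\lambda_n$ (with multiplicity). Let $1\le k\le n-1$ be such that $\lambda_1\le\cdots\le\lambda_k<0$ are the $k$ smallest eigenvalues of $A$, and put $$a_k=\max_{k+1\le i\le n}|\lambda_i|,\qquad b_k=\sum_{i=1}^k\lambda_i,$$ where $a_k>0$. Let $\underline{\boldsymbol{x}}\sim N(\underline 0,I_n)$ and $\boldsymbol{\Delta}=\underline{\boldsymbol{x}}^{\mathsf T}A\underline{\boldsymbol{x}}-\mathrm{tr}(A)$. If $t>0$ satisfies $$t+b_k\ge\frac{\sum_{i=k+1}^n\lambda_i^2}{a_k},$$ then $$\Pr(\boldsymbol{\Delta}>t)\le e^{-\frac{\kappa(t+b_k)}{a_k}}\prod_{i=1}^k\Big(2\kappa\frac{-\lambda_i}{a_k}+1\Big)^{-\frac12},$$ where $\kappa=\frac{b^*}{4}\approx0.1457$ and $b^*$ is the unique solution in $(0,1)$ of $\ln(1-b)=-\frac32b$. *)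

theory Defs
  imports "HOL-Probability.Probability" "HOL-Computational_Algebra.Polynomial"
begin

definition char_poly :: "'a::comm_ring_1 ^ 'n ^ 'n \<Rightarrow> 'a poly" where
  "char_poly A = det (mat [:0, 1:] - map_matrix (\<lambda>a. [:a:]) A)"

text \<open>The values of \<open>l\<close> outside the index range \<open>1, \<dots>, n\<close> are irrelevant. For a symmetric real
  matrix the algebraic multiplicities used here are also the geometric ones.\<close>
definition eigenvalues_of :: "real ^ 'n ^ 'n \<Rightarrow> (nat \<Rightarrow> real) \<Rightarrow> bool" where
  "eigenvalues_of A l \<longleftrightarrow> char_poly A = (\<Prod>i = 1..CARD('n). [:- l i, 1:])"

text \<open>Meaningful only for a positive definite covariance matrix \<open>C\<close>.\<close>
definition mvnormal_density :: "real ^ 'n \<Rightarrow> real ^ 'n ^ 'n \<Rightarrow> real ^ 'n \<Rightarrow> real" where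
  "mvnormal_density \<mu> C x =
     exp (- ((x - \<mu>) \<bullet> (matrix_inv C *v (x - \<mu>))) / 2) / sqrt ((2 * pi) ^ CARD('n) * det C)"

definition b_star :: real where
  "b_star = (THE b. 0 < b \<and> b < 1 \<and> ln (1 - b) = - (3 / 2) * b)"

definition kappa :: real where
  "kappa = b_star / 4"

lemma ln_bound_deriv:
  assumes "x < (1::real)"
  shows "((\<lambda>b. ln (1 - b) + 3 / 2 * b) has_real_derivative (3 / 2 - 1 / (1 - x))) (at x)"
  using assms by (auto intro!: derivative_eq_intros)

lemma lessThan_8: "{..<8::nat} = {0, 1, 2, 3, 4, 5, 6, 7}"
  by auto

lemma b_star_lower: "ln (1 - 0.5826 :: real) + 3 / 2 * 0.5826 > 0"
proof -
  have "ln (2087 / 5000 :: real) = ln (5000/2087) * (-1)" by (simp add: ln_div)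
  moreover have "ln (5000 / 2087 :: real) < 0.8739"
    using ln_approx_bounds[of "5000/2087 :: real" 8] by (simp add: lessThan_8 power_divide)
  ultimately show ?thesis by simp
qed

lemma b_star_upper: "ln (1 - 0.583 :: real) + 3 / 2 * 0.583 < 0"
proof -
  have "ln (417 / 1000 :: real) = ln (1000/417) * (-1)" by (simp add: ln_div)
  moreover have "ln (1000 / 417 :: real) > 0.8745"
    using ln_approx_bounds[of "1000/417 :: real" 8] by (simp add: lessThan_8 power_divide)
  ultimately show ?thesis by simp
qed

lemma b_star_unique: 
  fixes b :: real
  assumes "0 < b" "b < 1" "ln (1 - b) = - (3 / 2) * b" "0 < c" "c < 1" "ln (1 - c) = - (3 / 2) * c"
  shows "b = c"
proof -
  let ?g = "\<lambda>x::real. ln (1 - x) + 3 / 2 * x"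
  have main: False if h: "0 < b" "b < c" "c < 1" "?g b = 0" "?g c = 0" for b c :: real
  proof -
    obtain u where u: "0 < u" "u < b" "?g b - ?g 0 = (b - 0) * (3 / 2 - 1 / (1 - u))"
      using MVT2[of 0 b ?g "\<lambda>x. 3 / 2 - 1 / (1 - x)"] h ln_bound_deriv by force
    obtain v where v: "b < v" "v < c" "?g c - ?g b = (c - b) * (3 / 2 - 1 / (1 - v))"
      using MVT2[of b c ?g "\<lambda>x. 3 / 2 - 1 / (1 - x)"] h ln_bound_deriv by force
    have "(b - 0) * (3 / 2 - 1 / (1 - u)) = 0" using u(3) h(4) by simp
    moreover have "(c - b) * (3 / 2 - 1 / (1 - v)) = 0" using v(3) h(4,5) by linarith
    ultimately have "3 / 2 - 1 / (1 - u) = 0" "3 / 2 - 1 / (1 - v) = 0"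
      using h(1,2) by (metis diff_gt_0_iff_gt less_irrefl mult_eq_0_iff)+
    then have "1 / (1 - u) = 1 / (1 - v)" by linarith
    then show False using u v h by (simp add: divide_simps split: if_splits)
  qed
  show ?thesis
    using main[of b c] main[of c b] assms by (cases b c rule: linorder_cases) auto
qed

lemma b_star_exists:
  "\<exists>b::real. 0.5826 < b \<and> b < 0.583 \<and> ln (1 - b) = - (3 / 2) * b"
proof -
  let ?g = "\<lambda>x::real. ln (1 - x) + 3 / 2 * x"
  have "\<exists>x. 0.5826 \<le> x \<and> x \<le> 0.583 \<and> ?g x = 0"
  proof (rule IVT2')
    show "?g 0.583 \<le> 0" "0 \<le> ?g 0.5826"
      using b_star_lower b_star_upper by (simp_all only: less_imp_le)
    show "continuous_on {0.5826..0.583} ?g"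
      by (auto intro!: continuous_intros)
  qed simp
  then obtain x where x: "0.5826 \<le> x" "x \<le> 0.583" "?g x = 0" by blast
  then have "x \<noteq> 0.5826" "x \<noteq> 0.583"
    using b_star_lower b_star_upper by (metis less_irrefl)+
  with x show ?thesis by (intro exI[of _ x]) (auto simp: less_le)
qed

lemma ex1_b_star: "\<exists>!b::real. 0 < b \<and> b < 1 \<and> ln (1 - b) = - (3 / 2) * b"
proof -
  obtain b :: real where "0.5826 < b" "b < 0.583" "ln (1 - b) = - (3 / 2) * b"
    using b_star_exists by blast
  then have "0 < b \<and> b < 1 \<and> ln (1 - b) = - (3 / 2) * b" by simp
  then show ?thesis using b_star_unique by blast
qed

lemma b_star: "0 < b_star" "b_star < 1" "ln (1 - b_star) = - (3 / 2) * b_star"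
  using theI'[OF ex1_b_star] unfolding b_star_def by blast+

lemma kappa_approx: "\<bar>kappa - 0.1457\<bar> < 0.00005"
proof -
  obtain b :: real where b: "0.5826 < b" "b < 0.583" "ln (1 - b) = - (3 / 2) * b"
    using b_star_exists by blast
  then have "b_star = b" using b_star b_star_unique[of b_star b] by simp
  with b(1,2) show ?thesis
    unfolding kappa_def abs_less_iff by (intro conjI) (simp_all add: field_simps)
qed

end

theory Submission
  imports Defs
begin

text \<open>
  In an orthonormal eigenbasis of \<open>A\<close> (\<open>symmetric_matrix_diagonalization\<close>) the statistic becomes
  \<open>\<Sum>i. \<lambda>\<^sub>i (y\<^sub>i\<^sup>2 - 1)\<close> with independent standard normal \<open>y\<^sub>i\<close>, because the standard normal law is
  invariant under orthogonal maps (\<open>lborel_distr_orthogonal_transformation\<close>).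
  Hence its moment generating function is a product, and for \<open>\<theta> \<ge> 0\<close> with all \<open>2 \<theta> \<lambda>\<^sub>i < 1\<close>
  Markov's inequality for \<open>exp (\<theta> \<Delta>)\<close> bounds the tail probability by
  \<open>exp (- \<theta> t) \<Prod>i. exp (- \<theta> \<lambda>\<^sub>i) (1 - 2 \<theta> \<lambda>\<^sub>i) powr (- 1 / 2)\<close>;
  this is \<open>mvnormal_quadratic_form_Chernoff\<close>.

  The theorem is the choice \<open>\<theta> = b\<^sup>* / (2 a)\<close>, which makes \<open>2 \<theta> \<lambda>\<^sub>i \<le> b\<^sup>*\<close> for every \<open>i > k\<close>.
  The factors with \<open>i \<le> k\<close> are kept: their exponentials multiply to \<open>exp (- \<theta> b)\<close>, which turns \<open>t\<close>
  into \<open>t + b\<close>, and the remaining powers are at most those of the claim, where \<open>4 \<kappa> = b\<^sup>*\<close> has been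
  weakened to \<open>2 \<kappa>\<close>. For \<open>i > k\<close> the factor is at most \<open>exp (\<theta>\<^sup>2 \<lambda>\<^sub>i\<^sup>2 / b\<^sup>*)\<close> by the inequality
  \<open>ln (1 - x) \<ge> - x - x\<^sup>2 / (2 b\<^sup>*)\<close> for \<open>x \<le> b\<^sup>*\<close> (\<open>ln_one_minus_ge\<close>). The equation defining \<open>b\<^sup>*\<close>
  says that this inequality is an equality at \<open>x = b\<^sup>*\<close>. Since \<open>\<Sum>i>k. \<lambda>\<^sub>i\<^sup>2 \<le> a (t + b)\<close>, the total
  exponent is at most \<open>- \<theta> (t + b) + \<theta>\<^sup>2 a (t + b) / b\<^sup>* = - b\<^sup>* (t + b) / (4 a)\<close>.
\<close>

section \<open>Orthogonal diagonalization of real symmetric matrices\<close>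

text \<open>A maximizer \<open>v\<close> of \<open>x \<bullet> T x\<close> on the unit sphere of \<open>S\<close> is an eigenvector: with \<open>c\<close> the maximum,
  \<open>c (x \<bullet> x) - x \<bullet> T x\<close> is a positive semidefinite form on \<open>S\<close> vanishing at \<open>v\<close>, so its
  derivative at \<open>v\<close>, which is \<open>2 (c v - T v)\<close>, vanishes too.\<close>

lemma self_adjoint_eigenvector_exists:
  fixes T :: "'a::euclidean_space \<Rightarrow> 'a"
  assumes T: "linear T" and adj: "\<And>x y. x \<bullet> T y = T x \<bullet> y"
    and S: "subspace S" "S \<noteq> {0}" and inv: "\<And>x. x \<in> S \<Longrightarrow> T x \<in> S"
  obtains v c where "v \<in> S" "norm v = 1" "T v = c *\<^sub>R v"
proof -
  interpret linear T by fact
  obtain u where u: "u \<in> S" "u \<noteq> 0"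
    using S subspace_0 by blast
  let ?K = "sphere 0 1 \<inter> S"
  have "compact ?K"
    using closed_subspace[OF S(1)] by (simp add: compact_Int_closed)
  moreover have "u /\<^sub>R norm u \<in> ?K"
    using u S(1) by (simp add: subspace_scale)
  moreover have "continuous_on ?K (\<lambda>x. x \<bullet> T x)"
    using T by (intro continuous_intros linear_continuous_on_compose[of _ _ T, OF continuous_on_id]) auto
  ultimately obtain v where v: "v \<in> ?K" and max: "\<And>y. y \<in> ?K \<Longrightarrow> y \<bullet> T y \<le> v \<bullet> T v"
    using continuous_attains_sup[of ?K "\<lambda>x. x \<bullet> T x"] by (metis empty_iff)
  define c where "c = v \<bullet> T v"
  have vv: "v \<bullet> v = 1"
    using v by (simp add: norm_eq_1)
  have bound: "w \<bullet> T w \<le> c * (w \<bullet> w)" if "w \<in> S" for w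
  proof (cases "w = 0")
    case False
    have "(w /\<^sub>R norm w) \<bullet> T (w /\<^sub>R norm w) \<le> c"
      unfolding c_def using that False S(1) by (intro max) (simp add: subspace_scale)
    then have "(w \<bullet> T w) / (norm w)\<^sup>2 \<le> c"
      by (simp add: scale power2_eq_square divide_inverse mult_ac)
    then show ?thesis
      using False by (simp add: divide_le_eq dot_square_norm)
  qed (simp add: zero)
  define r where "r = c *\<^sub>R v - T v"
  have r: "r \<in> S"
    unfolding r_def using v inv S(1) by (simp add: subspace_diff subspace_scale)
  have vr: "v \<bullet> r = 0"
    unfolding r_def by (simp add: inner_diff_right vv c_def)
  \<comment> \<open>Perturbing \<open>v\<close> in the direction \<open>s r\<close> changes the form \<open>c |w|\<^sup>2 - w \<bullet> T w \<ge> 0\<close> to first order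
    by \<open>2 s |r|\<^sup>2\<close>, which for small negative \<open>s\<close> is only possible if \<open>r = 0\<close>.\<close>
  have quad: "0 \<le> 2 * s * (r \<bullet> r) + s\<^sup>2 * (c * (r \<bullet> r) - r \<bullet> T r)" for s
  proof -
    have "(v + s *\<^sub>R r) \<bullet> T (v + s *\<^sub>R r) \<le> c * ((v + s *\<^sub>R r) \<bullet> (v + s *\<^sub>R r))"
      using v r S(1) by (intro bound) (simp add: subspace_add subspace_scale)
    moreover have "v \<bullet> T r = - (r \<bullet> r)" "r \<bullet> T v = - (r \<bullet> r)"
    proof -
      have "r \<bullet> r = c * (r \<bullet> v) - r \<bullet> T v"
        by (subst (2) r_def) (simp add: inner_diff_right)
      then show "r \<bullet> T v = - (r \<bullet> r)" using vr by (simp add: inner_commute)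
      then show "v \<bullet> T r = - (r \<bullet> r)" using adj[of v r] by (simp add: inner_commute)
    qed
    ultimately show ?thesis
      using vr vv c_def
      by (simp add: add scale inner_simps inner_commute[of r v] power2_eq_square algebra_simps)
  qed
  have "r \<bullet> r = 0"
  proof (rule ccontr)
    assume "r \<bullet> r \<noteq> 0"
    then have p: "r \<bullet> r > 0" by simp
    define q where "q = \<bar>c * (r \<bullet> r) - r \<bullet> T r\<bar> + 1"
    define s where "s = - (r \<bullet> r) / q"
    have q: "q > 0" "c * (r \<bullet> r) - r \<bullet> T r \<le> q" unfolding q_def by auto
    have "2 * s * (r \<bullet> r) + s\<^sup>2 * (c * (r \<bullet> r) - r \<bullet> T r) \<le> 2 * s * (r \<bullet> r) + s\<^sup>2 * q"
      using q by (simp add: mult_left_mono)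
    also have "\<dots> = - (r \<bullet> r)\<^sup>2 / q"
      using q unfolding s_def by (simp add: field_simps power2_eq_square)
    also have "\<dots> < 0" using p q by (simp add: divide_neg_pos)
    finally show False using quad[of s] by simp
  qed
  then have "T v = c *\<^sub>R v" by (simp add: r_def)
  then show ?thesis
    using v by (intro that[of v c]) auto
qed

text \<open>Split off one eigenvector \<open>v\<close>: by self-adjointness its orthogonal complement inside \<open>S\<close> is again
  invariant, and it has smaller dimension.\<close>

lemma self_adjoint_orthonormal_eigenbasis:
  fixes T :: "'a::euclidean_space \<Rightarrow> 'a"
  assumes T: "linear T" and adj: "\<And>x y. x \<bullet> T y = T x \<bullet> y"
    and "subspace S" "\<And>x. x \<in> S \<Longrightarrow> T x \<in> S"
  shows "\<exists>B \<subseteq> S. pairwise orthogonal B \<and> (\<forall>v\<in>B. norm v = 1 \<and> (\<exists>c. T v = c *\<^sub>R v)) \<and> span B = S"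
  using assms(3,4)
proof (induction "dim S" arbitrary: S rule: less_induct)
  case less
  show ?case
  proof (cases "S = {0}")
    case True
    then show ?thesis by (intro exI[of _ "{}"]) auto
  next
    case False
    obtain v c where v: "v \<in> S" "norm v = 1" "T v = c *\<^sub>R v"
      using self_adjoint_eigenvector_exists[OF T adj less.prems(1) False less.prems(2)] by metis
    have vv: "v \<bullet> v = 1" using v by (simp add: norm_eq_1)
    let ?S' = "S \<inter> {x. v \<bullet> x = 0}"
    have sub: "subspace ?S'"
      using less.prems(1) by (intro subspace_inter subspace_hyperplane)
    have "v \<notin> ?S'" using vv by simp
    then have "?S' \<subset> S" using v by blast
    then have "span ?S' \<subset> span S" using sub less.prems(1) by (metis span_eq_iff)
    then have "dim ?S' < dim S" by (rule dim_psubset)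
    moreover have "T x \<in> ?S'" if "x \<in> ?S'" for x
      using that less.prems(2) adj[of v x] v(3) by simp
    ultimately obtain B where B: "B \<subseteq> ?S'" "pairwise orthogonal B"
      "\<forall>v\<in>B. norm v = 1 \<and> (\<exists>c. T v = c *\<^sub>R v)" "span B = ?S'"
      using less.hyps[OF _ sub] by meson
    have "S \<subseteq> span (insert v B)"
    proof
      fix x assume x: "x \<in> S"
      have "x - (v \<bullet> x) *\<^sub>R v \<in> ?S'"
        using x v(1) vv less.prems(1) by (simp add: subspace_diff subspace_scale inner_diff_right)
      then show "x \<in> span (insert v B)"
        using B(4) span_breakdown_eq by blast
    qed
    moreover have "span (insert v B) \<subseteq> S"
      using B(1) v(1) less.prems(1) by (intro span_minimal) auto
    moreover have "pairwise orthogonal (insert v B)"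
      using B(1,2) by (auto simp: pairwise_insert orthogonal_def inner_commute)
    ultimately show ?thesis
      using B(1,3) v by (intro exI[of _ "insert v B"]) auto
  qed
qed

definition diagonal_matrix :: "('n \<Rightarrow> 'a::zero) \<Rightarrow> 'a ^ 'n ^ 'n" where
  "diagonal_matrix d = (\<chi> i j. if i = j then d i else 0)"

theorem symmetric_matrix_diagonalization:
  fixes A :: "real ^ 'n ^ 'n"
  assumes sym: "transpose A = A"
  obtains P d where "orthogonal_matrix P" "A = transpose P ** diagonal_matrix d ** P"
proof -
  have adj: "x \<bullet> (A *v y) = (A *v x) \<bullet> y" for x y
    by (metis dot_lmul_matrix sym vector_transpose_matrix)
  obtain B where B: "pairwise orthogonal B"
    "\<forall>v\<in>B. norm v = 1 \<and> (\<exists>c. A *v v = c *\<^sub>R v)" "span B = UNIV"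
    using self_adjoint_orthonormal_eigenbasis[OF matrix_vector_mul_linear[of A] adj subspace_UNIV] by auto
  have "independent B"
    using B(1,2) by (intro pairwise_orthogonal_independent) auto
  then have fin: "finite B" and "card B = CARD('n)"
    using dim_eq_card[of B UNIV] independent_imp_finite B(3) by auto
  then obtain \<phi> :: "'n \<Rightarrow> real ^ 'n" where \<phi>: "bij_betw \<phi> UNIV B"
    using finite_same_card_bij[of "UNIV :: 'n set" B] by auto
  have \<phi>B: "\<phi> i \<in> B" for i using \<phi> by (auto simp: bij_betw_def)
  have ortho: "\<phi> i \<bullet> \<phi> j = (if i = j then 1 else 0)" for i j
  proof (cases "i = j")
    case True
    then show ?thesis using B(2) \<phi>B[of j] by (simp add: norm_eq_1)
  next
    case False
    then have "\<phi> i \<noteq> \<phi> j" using \<phi> by (auto simp: bij_betw_def inj_def)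
    then show ?thesis using False B(1) \<phi>B by (auto simp: pairwise_def orthogonal_def)
  qed
  have "\<exists>c. A *v \<phi> i = c *\<^sub>R \<phi> i" for i
    using B(2) \<phi>B[of i] by blast
  then obtain d where d: "\<And>i. A *v \<phi> i = d i *\<^sub>R \<phi> i"
    by metis
  define P where "P = (\<chi> i. \<phi> i)"
  have PPt: "P ** transpose P = mat 1"
  proof -
    have "(P ** transpose P) $ i $ j = \<phi> i \<bullet> \<phi> j" for i j
      by (simp add: P_def matrix_matrix_mult_def transpose_def inner_vec_def)
    then show ?thesis by (simp add: vec_eq_iff mat_def ortho)
  qed
  then have P: "transpose P ** P = mat 1" "orthogonal_matrix P"
    using matrix_left_right_inverse[of P "transpose P"] by (simp_all add: orthogonal_matrix_def)
  have "A ** transpose P = transpose P ** diagonal_matrix d"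
  proof -
    have "(A ** transpose P) $ i $ j = (A *v \<phi> j) $ i" for i j
      by (simp add: matrix_matrix_mult_def transpose_def P_def matrix_vector_mult_def)
    moreover have "(transpose P ** diagonal_matrix d) $ i $ j = d j * \<phi> j $ i" for i j
      by (simp add: matrix_matrix_mult_def transpose_def P_def diagonal_matrix_def if_distrib[of "(*) _"] cong: if_cong)
    ultimately show ?thesis by (simp add: vec_eq_iff d)
  qed
  then have "A ** transpose P ** P = transpose P ** diagonal_matrix d ** P" by simp
  then have "A = transpose P ** diagonal_matrix d ** P"
    by (simp add: P(1) flip: matrix_mul_assoc)
  with P(2) that show ?thesis by blast
qed

text \<open>Evaluation at a point is a ring homomorphism, so it commutes with the determinant.\<close>

lemma poly_char_poly: "poly (char_poly A) x = det (mat x - A)"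
  for A :: "'a::comm_ring_1 ^ 'n ^ 'n"
proof -
  have of_int_poly: "poly (of_int z) x = of_int z" for z
    by (metis of_int_poly poly_pCons mult_zero_right add.right_neutral poly_0)
  show ?thesis
    unfolding char_poly_def det_def
    by (intro trans[OF poly_sum] sum.cong refl)
       (auto simp: poly_prod of_int_poly mat_def map_matrix_def if_distrib[of "\<lambda>p. poly p x"] cong: if_cong intro!: prod.cong)
qed

lemma char_poly_orthogonal_diagonalization:
  fixes A :: "real ^ 'n ^ 'n"
  assumes P: "orthogonal_matrix P" and A: "A = transpose P ** diagonal_matrix d ** P"
  shows "char_poly A = (\<Prod>i\<in>UNIV. [:- d i, 1:])"
proof -
  have PP: "transpose P ** P = mat 1" "det (transpose P) * det P = 1"
    using P by (simp_all add: orthogonal_matrix_def flip: det_mul del: det_transpose)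
  have "poly (char_poly A) x = (\<Prod>i\<in>UNIV. x - d i)" for x
  proof -
    have "mat x = x *\<^sub>R (transpose P ** P)"
      by (simp add: PP(1) mat_def vec_eq_iff)
    also have "\<dots> = transpose P ** mat x ** P"
    proof -
      have "transpose P ** mat x = x *\<^sub>R transpose P"
        by (simp add: matrix_matrix_mult_def mat_def vec_eq_iff if_distrib[of "(*) _"] cong: if_cong)
      then show ?thesis by (simp add: scalar_matrix_assoc)
    qed
    finally have "mat x = transpose P ** ((mat x - diagonal_matrix d) + diagonal_matrix d) ** P"
      by simp
    also have "\<dots> = transpose P ** (mat x - diagonal_matrix d) ** P + A"
      unfolding matrix_add_ldistrib A
      by (simp add: matrix_matrix_mult_def[of _ P] vec_eq_iff distrib_right sum.distrib)
    finally have "mat x - A = transpose P ** (mat x - diagonal_matrix d) ** P"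
      by (simp only: diff_eq_eq)
    then have "det (mat x - A) = det (mat x - diagonal_matrix d) * (det (transpose P) * det P)"
      by (simp only: det_mul mult_ac)
    also have "\<dots> = (\<Prod>i\<in>UNIV. x - d i)"
      by (subst det_diagonal) (auto simp: PP(2) mat_def diagonal_matrix_def simp del: det_transpose)
    finally show ?thesis by (simp add: poly_char_poly)
  qed
  then show ?thesis
    by (intro poly_ext) (simp add: poly_prod)
qed

text \<open>Comparing roots of the characteristic polynomial identifies the diagonal entries, indexed by
  the type \<open>'n\<close>, with the given numerical list of eigenvalues, up to order.\<close>

lemma eigenvalues_of_orthogonal_diagonalization:
  fixes A :: "real ^ 'n ^ 'n"
  assumes "orthogonal_matrix P" "A = transpose P ** diagonal_matrix d ** P" "eigenvalues_of A l"
  shows "image_mset d (mset_set UNIV) = image_mset l (mset_set {1..CARD('n)})"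
proof -
  have roots: "proots (\<Prod>i\<in>I. [:- f i, 1:]) = image_mset f (mset_set I)"
    if "finite I" for I :: "'b set" and f :: "'b \<Rightarrow> real"
    by (subst proots_prod, simp, use that in \<open>induction I rule: finite_induct; simp\<close>)
  have "(\<Prod>i\<in>UNIV. [:- d i, 1:]) = (\<Prod>i = 1..CARD('n). [:- l i, 1:])"
    using assms char_poly_orthogonal_diagonalization unfolding eigenvalues_of_def by metis
  then show ?thesis
    using roots[of "UNIV :: 'n set" d] roots[of "{1..CARD('n)}" l] by simp
qed

lemma trace_orthogonal_diagonalization:
  fixes A :: "real ^ 'n ^ 'n"
  assumes P: "orthogonal_matrix P" and A: "A = transpose P ** diagonal_matrix d ** P"
  shows "trace A = (\<Sum>i\<in>UNIV. d i)"
proof -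
  have "trace A = trace (diagonal_matrix d ** (P ** transpose P))"
    unfolding A by (metis matrix_mul_assoc trace_mul_sym)
  then show ?thesis
    using P by (simp add: orthogonal_matrix_def trace_def diagonal_matrix_def)
qed

lemma quadratic_form_orthogonal_diagonalization:
  fixes A :: "real ^ 'n ^ 'n"
  assumes A: "A = transpose P ** diagonal_matrix d ** P"
  shows "x \<bullet> (A *v x) = (\<Sum>i\<in>UNIV. d i * ((P *v x) $ i)\<^sup>2)"
proof -
  have "x \<bullet> (A *v x) = (P *v x) \<bullet> (diagonal_matrix d *v (P *v x))"
    unfolding A
    by (metis dot_lmul_matrix matrix_vector_mul_assoc vector_transpose_matrix)
  also have "diagonal_matrix d *v y = (\<chi> i. d i * y $ i)" for y
    by (simp add: matrix_vector_mult_def diagonal_matrix_def if_distrib[of "\<lambda>z. z * _"] vec_eq_iff cong: if_cong)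
  finally show ?thesis
    by (simp add: inner_vec_def power2_eq_square mult_ac)
qed


section \<open>Gaussian integrals of quadratic forms\<close>

text \<open>The image \<open>\<mu>\<close> of Lebesgue measure is translation invariant, and such a measure is a multiple
  of Lebesgue measure: writing the product of the Lebesgue measure of \<open>A\<close> and the \<open>\<mu>\<close>-measure of
  a ball as a double integral and shifting each variable in turn exchanges the two measures. An
  orthogonal map preserves the unit ball, so the factor is 1.\<close>

lemma lborel_distr_orthogonal_transformation:
  fixes f :: "'a::euclidean_space \<Rightarrow> 'a"
  assumes f: "orthogonal_transformation f"
  shows "distr lborel borel f = lborel"
proof (rule measure_eqI)
  fix A assume "A \<in> sets (distr lborel borel f)"
  then have [measurable]: "A \<in> sets borel" by simp
  have lin: "linear f" using f by (rule orthogonal_transformation_linear)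
  have [measurable]: "f \<in> borel_measurable borel"
    using lin by (intro borel_measurable_continuous_onI linear_continuous_on_compose[OF continuous_on_id])
  let ?\<mu> = "distr lborel borel f" and ?B = "ball 0 1 :: 'a set"
  have B [measurable]: "?B \<in> sets borel" by simp
  have shift: "(\<integral>\<^sup>+x. g (x + y) \<partial>lborel) = (\<integral>\<^sup>+x. g x \<partial>lborel)"
    if [measurable]: "g \<in> borel_measurable borel" for g :: "'a \<Rightarrow> ennreal" and y
  proof -
    have "(\<integral>\<^sup>+x. g x \<partial>distr lborel borel ((+) y)) = (\<integral>\<^sup>+x. g (y + x) \<partial>lborel)"
      by (rule nn_integral_distr) auto
    then show ?thesis
      by (simp only: lborel_distr_plus add.commute[of y])
  qed
  have shift': "(\<integral>\<^sup>+x. g (x + y) \<partial>?\<mu>) = (\<integral>\<^sup>+x. g x \<partial>?\<mu>)"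
    if [measurable]: "g \<in> borel_measurable borel" for g :: "'a \<Rightarrow> ennreal" and y
  proof -
    obtain z where "y = f z"
      using f orthogonal_transformation_surj by (metis surjD)
    then show ?thesis
      using shift[of "\<lambda>x. g (f x)" z] lin by (simp add: nn_integral_distr linear_add)
  qed
  have pre: "f -` ?B = ?B"
    using f by (auto simp: orthogonal_transformation_norm)
  have \<mu>B: "emeasure ?\<mu> ?B = emeasure lborel ?B"
    by (simp add: emeasure_distr pre)
  \<comment> \<open>By the symmetry of the ball, \<open>y - x\<close> lies in it exactly for \<open>x\<close> in its translate by \<open>y\<close>.\<close>
  have refl: "(\<integral>\<^sup>+x. indicator ?B (y - x) \<partial>lborel) = emeasure lborel ?B" for y
  proof -
    have "(\<integral>\<^sup>+x. indicator ?B (y - x) \<partial>lborel) = (\<integral>\<^sup>+x. indicator ?B (x + (- y)) \<partial>lborel)"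
      by (intro nn_integral_cong) (auto simp: indicator_def norm_minus_commute)
    also have "\<dots> = (\<integral>\<^sup>+x. indicator ?B x \<partial>lborel)"
      by (rule shift, rule borel_measurable_indicator[OF B])
    finally show ?thesis by simp
  qed
  interpret \<mu>: sigma_finite_measure ?\<mu>
  proof (rule sigma_finite_measure.intro, intro exI[of _ "range (\<lambda>n::nat. ball (0::'a) (real n))"] conjI ballI)
    show "countable (range (\<lambda>n::nat. ball (0::'a) (real n)))" by simp
    show "range (\<lambda>n::nat. ball (0::'a) (real n)) \<subseteq> sets ?\<mu>" by auto
    show "\<Union> (range (\<lambda>n::nat. ball (0::'a) (real n))) = space ?\<mu>"
      by (auto intro: reals_Archimedean2)
    fix C assume "C \<in> range (\<lambda>n::nat. ball (0::'a) (real n))"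
    then obtain n :: nat where C: "C = ball 0 (real n)" by auto
    have "f -` C = C"
      using f unfolding C by (auto simp: orthogonal_transformation_norm)
    then have "emeasure ?\<mu> C = emeasure lborel C"
      by (simp add: emeasure_distr C)
    also have "\<dots> < \<infinity>" unfolding C by (rule emeasure_bounded_finite) simp
    finally show "emeasure ?\<mu> C \<noteq> \<infinity>" by simp
  qed
  interpret pair_sigma_finite lborel ?\<mu> ..
  have "emeasure lborel ?B * emeasure lborel A
      = (\<integral>\<^sup>+y. indicator ?B y * (\<integral>\<^sup>+x. indicator A (x + y) \<partial>lborel) \<partial>?\<mu>)"
    by (subst shift) (auto simp: nn_integral_multc \<mu>B)
  also have "\<dots> = (\<integral>\<^sup>+y. (\<integral>\<^sup>+x. indicator ?B y * indicator A (x + y) \<partial>lborel) \<partial>?\<mu>)"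
    by (intro nn_integral_cong nn_integral_cmult[symmetric]) measurable
  also have "\<dots> = (\<integral>\<^sup>+x. (\<integral>\<^sup>+y. indicator ?B y * indicator A (x + y) \<partial>?\<mu>) \<partial>lborel)"
    by (rule Fubini') measurable
  also have "\<dots> = (\<integral>\<^sup>+x. (\<integral>\<^sup>+y. indicator ?B (y - x) * indicator A y \<partial>?\<mu>) \<partial>lborel)"
  proof (rule nn_integral_cong)
    fix x
    show "(\<integral>\<^sup>+y. indicator ?B y * indicator A (x + y) \<partial>?\<mu>)
        = (\<integral>\<^sup>+y. indicator ?B (y - x) * indicator A y \<partial>?\<mu>)"
      using shift'[of "\<lambda>y. indicator ?B (y - x) * indicator A y" x] by (simp add: add.commute)
  qed
  also have "\<dots> = (\<integral>\<^sup>+y. (\<integral>\<^sup>+x. indicator ?B (y - x) * indicator A y \<partial>lborel) \<partial>?\<mu>)"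
    by (rule Fubini'[symmetric]) measurable
  also have "\<dots> = (\<integral>\<^sup>+y. emeasure lborel ?B * indicator A y \<partial>?\<mu>)"
    by (intro nn_integral_cong) (simp add: nn_integral_multc refl)
  also have "\<dots> = emeasure lborel ?B * emeasure ?\<mu> A"
    by (simp add: nn_integral_cmult)
  finally have "emeasure lborel ?B * emeasure ?\<mu> A = emeasure lborel ?B * emeasure lborel A" by simp
  moreover have "emeasure lborel ?B \<noteq> 0"
    using content_ball_pos[of 1 "0::'a"] by (auto simp: measure_def)
  moreover have "emeasure lborel ?B \<noteq> \<infinity>"
    using emeasure_bounded_finite[of ?B] by simp
  ultimately show "emeasure ?\<mu> A = emeasure lborel A"
    by (simp add: ennreal_mult_cancel_left)
qed simp

lemma nn_integral_lborel_cart_prod: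
  fixes f :: "'n::finite \<Rightarrow> real \<Rightarrow> ennreal"
  assumes [measurable]: "\<And>i. f i \<in> borel_measurable borel"
  shows "(\<integral>\<^sup>+x. (\<Prod>i\<in>UNIV. f i (x $ i)) \<partial>(lborel :: (real ^ 'n) measure)) = (\<Prod>i\<in>UNIV. \<integral>\<^sup>+x. f i x \<partial>lborel)"
proof -
  let ?e = "\<lambda>i::'n. axis i (1::real)"
  have inj: "inj ?e" by (auto simp: inj_def axis_eq_axis)
  have Basis: "(Basis :: (real ^ 'n) set) = range ?e" by (auto simp: Basis_vec_def)
  have "(\<integral>\<^sup>+x. (\<Prod>b\<in>Basis. f (inv ?e b) (x \<bullet> b)) \<partial>(lborel :: (real ^ 'n) measure))
      = (\<Prod>b\<in>Basis. \<integral>\<^sup>+x. f (inv ?e b) x \<partial>lborel)"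
    by (rule nn_integral_lborel_prod) auto
  then show ?thesis
    by (simp add: Basis prod.reindex[OF inj] inv_f_f[OF inj] inner_axis)
qed

text \<open>Up to normalization the integrand is the normal density with variance \<open>1 / c\<close>.\<close>

lemma nn_integral_gaussian:
  assumes c: "c > 0"
  shows "(\<integral>\<^sup>+x. ennreal (exp (- (c * x\<^sup>2) / 2) / sqrt (2 * pi)) \<partial>lborel) = ennreal (c powr (- 1 / 2))"
proof -
  let ?\<sigma> = "1 / sqrt c"
  have "exp (- (c * x\<^sup>2) / 2) / sqrt (2 * pi) = c powr (- 1 / 2) * normal_density 0 ?\<sigma> x" for x
    using c by (simp add: normal_density_def powr_minus powr_half_sqrt real_sqrt_divide field_simps)
  moreover have "(\<integral>\<^sup>+x. ennreal (normal_density 0 ?\<sigma> x) \<partial>lborel) = 1"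
    using c by (subst nn_integral_eq_integral) auto
  ultimately show ?thesis
    using c by (simp add: ennreal_mult nn_integral_cmult)
qed

lemma standard_mvnormal_density:
  "mvnormal_density 0 (mat 1) x = exp (- (x \<bullet> x) / 2) / sqrt (2 * pi) ^ CARD('n)"
  for x :: "real ^ 'n"
proof -
  have "matrix_inv (mat 1 :: real ^ 'n ^ 'n) = mat 1"
    unfolding matrix_inv_def by (rule some_equality) auto
  then show ?thesis
    by (simp add: mvnormal_density_def real_sqrt_power[symmetric] power_mult_distrib)
qed

text \<open>The moment generating function of a quadratic form in a standard normal vector, the form being
  diagonal in the coordinates \<open>y = P x\<close>. The Gaussian density depends on \<open>y \<bullet> y = x \<bullet> x\<close> only, so
  after the change of variables the integrand is a product of one-dimensional Gaussians.\<close>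

lemma nn_integral_mvnormal_exp_diagonal_form:
  fixes P :: "real ^ 'n ^ 'n" and d :: "'n \<Rightarrow> real"
  assumes P: "orthogonal_matrix P" and d: "\<And>i. 2 * \<theta> * d i < 1"
  shows "(\<integral>\<^sup>+x. ennreal (mvnormal_density 0 (mat 1) x) * ennreal (exp (\<theta> * (\<Sum>i\<in>UNIV. d i * ((P *v x) $ i)\<^sup>2))) \<partial>lborel)
    = ennreal (\<Prod>i\<in>UNIV. (1 - 2 * \<theta> * d i) powr (- 1 / 2))"
proof -
  have orth: "orthogonal_transformation ((*v) P)"
    using P by (simp add: orthogonal_transformation_matrix)
  then have norm: "(P *v x) \<bullet> (P *v x) = x \<bullet> x" for x
    by (simp add: orthogonal_transformation_def)
  have [measurable]: "(*v) P \<in> borel_measurable borel"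
    by (intro borel_measurable_continuous_onI matrix_vector_mult_linear_continuous_on)
  let ?f = "\<lambda>i x. ennreal (exp (- ((1 - 2 * \<theta> * d i) * x\<^sup>2) / 2) / sqrt (2 * pi))"
  have split: "ennreal (mvnormal_density 0 (mat 1) y) * ennreal (exp (\<theta> * (\<Sum>i\<in>UNIV. d i * (y $ i)\<^sup>2)))
      = (\<Prod>i\<in>UNIV. ?f i (y $ i))" for y :: "real ^ 'n"
  proof -
    have "exp (- (y \<bullet> y) / 2) * exp (\<theta> * (\<Sum>i\<in>UNIV. d i * (y $ i)\<^sup>2))
        = exp (\<Sum>i\<in>UNIV. - ((1 - 2 * \<theta> * d i) * (y $ i)\<^sup>2) / 2)"
      unfolding exp_add[symmetric] inner_vec_def sum_distrib_left minus_divide_left sum_negf[symmetric]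
        sum_divide_distrib sum.distrib[symmetric]
      by (intro arg_cong[of _ _ exp] sum.cong) (auto simp: field_simps power2_eq_square)
    then show ?thesis
      by (simp add: standard_mvnormal_density prod_ennreal prod_dividef exp_sum flip: ennreal_mult)
  qed
  have "(\<integral>\<^sup>+x. ennreal (mvnormal_density 0 (mat 1) x) * ennreal (exp (\<theta> * (\<Sum>i\<in>UNIV. d i * ((P *v x) $ i)\<^sup>2))) \<partial>lborel)
      = (\<integral>\<^sup>+x. (\<Prod>i\<in>UNIV. ?f i ((P *v x) $ i)) \<partial>lborel)"
    by (intro nn_integral_cong, subst split[symmetric]) (simp add: standard_mvnormal_density norm)
  also have "\<dots> = (\<integral>\<^sup>+y. (\<Prod>i\<in>UNIV. ?f i (y $ i)) \<partial>distr lborel borel ((*v) P))"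
    by (subst nn_integral_distr) auto
  also have "\<dots> = (\<Prod>i\<in>UNIV. \<integral>\<^sup>+x. ?f i x \<partial>lborel)"
    unfolding lborel_distr_orthogonal_transformation[OF orth]
    by (rule nn_integral_lborel_cart_prod) simp
  also have "\<dots> = (\<Prod>i\<in>UNIV. ennreal ((1 - 2 * \<theta> * d i) powr (- 1 / 2)))"
    using d by (intro prod.cong refl nn_integral_gaussian) simp
  finally show ?thesis by (simp add: prod_ennreal)
qed

section \<open>The elementary inequality behind the constant\<close>

text \<open>The difference of the two sides vanishes at \<open>0\<close> and, by the equation for \<open>b\<close>, at \<open>b\<close>. The sign
  of its derivative is that of \<open>x ((1 - b) - x)\<close>, so it decreases to \<open>0\<close> on the negative axis,
  increases on \<open>[0, 1 - b]\<close> and decreases to its zero at \<open>b\<close> from there on.\<close>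

lemma ln_one_minus_ge:
  assumes b: "0 < b" "b < 1" "ln (1 - b) = - (3 / 2) * b" and x: "x \<le> (b::real)"
  shows "ln (1 - x) \<ge> - x - x\<^sup>2 / (2 * b)"
proof -
  define h where "h = (\<lambda>x::real. ln (1 - x) + x + x\<^sup>2 / (2 * b))"
  have deriv: "(h has_real_derivative (y * ((1 - b) - y) / (b * (1 - y)))) (at y)" if "y \<le> b" for y
    unfolding h_def using that b
    by (auto intro!: derivative_eq_intros simp: field_simps power2_eq_square)
  have h0: "h 0 = 0" "h b = 0"
    using b by (simp_all add: h_def power2_eq_square)
  consider "x \<le> 0" | "0 \<le> x" "x \<le> 1 - b" | "1 - b \<le> x" by linarith
  then have "0 \<le> h x"
  proof cases
    case 1
    have "h 0 \<le> h x"
    proof (rule DERIV_nonpos_imp_nonincreasing[OF 1])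
      fix y assume y: "x \<le> y" "y \<le> 0"
      then have "y * ((1 - b) - y) / (b * (1 - y)) \<le> 0"
        using b by (intro divide_nonpos_pos mult_nonpos_nonneg) auto
      then show "\<exists>z. (h has_real_derivative z) (at y) \<and> z \<le> 0"
        using deriv[of y] y b by fastforce
    qed
    then show ?thesis by (simp add: h0)
  next
    case 2
    have "h 0 \<le> h x"
    proof (rule DERIV_nonneg_imp_nondecreasing[OF 2(1)])
      fix y assume y: "0 \<le> y" "y \<le> x"
      then have "0 \<le> y * ((1 - b) - y) / (b * (1 - y))"
        using b 2 by (intro divide_nonneg_pos mult_nonneg_nonneg) auto
      then show "\<exists>z. (h has_real_derivative z) (at y) \<and> 0 \<le> z"
        using deriv[of y] y x by fastforce
    qed
    then show ?thesis by (simp add: h0)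
  next
    case 3
    have "h b \<le> h x"
    proof (rule DERIV_nonpos_imp_nonincreasing[OF x])
      fix y assume y: "x \<le> y" "y \<le> b"
      then have "y * ((1 - b) - y) / (b * (1 - y)) \<le> 0"
        using b 3 by (intro divide_nonpos_pos mult_nonneg_nonpos) auto
      then show "\<exists>z. (h has_real_derivative z) (at y) \<and> z \<le> 0"
        using deriv[of y] y by fastforce
    qed
    then show ?thesis by (simp add: h0)
  qed
  then show ?thesis by (simp add: h_def)
qed

text \<open>With \<open>x = 2 \<theta> \<lambda>\<close> the left side is the moment generating function at \<open>\<theta>\<close> of
  \<open>\<lambda> (y\<^sup>2 - 1)\<close>, \<open>y\<close> standard normal.\<close>

lemma centred_square_mgf_factor_le:
  assumes "x \<le> b_star"
  shows "exp (- x / 2) * (1 - x) powr (- 1 / 2) \<le> exp (x\<^sup>2 / (4 * b_star))"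
proof -
  have "1 - x > 0" using assms b_star by simp
  then have "exp (- x / 2) * (1 - x) powr (- 1 / 2) = exp (- x / 2 - ln (1 - x) / 2)"
    by (simp add: powr_def flip: exp_add)
  also have "\<dots> \<le> exp (x\<^sup>2 / (4 * b_star))"
    using ln_one_minus_ge[OF b_star assms] by simp
  finally show ?thesis .
qed


section \<open>The tail bound\<close>

text \<open>Markov's inequality for \<open>exp (\<theta> (X \<bullet> A X - trace A))\<close>, whose expectation is finite by the
  condition on \<open>\<theta>\<close> and depends on the spectrum of \<open>A\<close> alone.\<close>

lemma mvnormal_quadratic_form_Chernoff:
  fixes A :: "real ^ 'n ^ 'n" and X :: "'w \<Rightarrow> real ^ 'n"
  assumes sym: "transpose A = A" and eig: "eigenvalues_of A l"
    and prob: "prob_space M"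
    and normal: "distributed M lborel X (mvnormal_density 0 (mat 1))"
    and \<theta>: "0 \<le> \<theta>" "\<And>i. i \<in> {1..CARD('n)} \<Longrightarrow> 2 * \<theta> * l i < 1"
  shows "\<P>(\<omega> in M. X \<omega> \<bullet> (A *v X \<omega>) - trace A > t)
    \<le> exp (- \<theta> * t) * (\<Prod>i=1..CARD('n). exp (- \<theta> * l i) * (1 - 2 * \<theta> * l i) powr (- 1 / 2))"
proof -
  interpret prob_space M by fact
  obtain P d where P: "orthogonal_matrix P" and A: "A = transpose P ** diagonal_matrix d ** P"
    using symmetric_matrix_diagonalization[OF sym] by blast
  have spectrum: "image_mset d (mset_set UNIV) = image_mset l (mset_set {1..CARD('n)})"
    by (rule eigenvalues_of_orthogonal_diagonalization[OF P A eig])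
  have d: "2 * \<theta> * d i < 1" for i
  proof -
    have "d i \<in># image_mset l (mset_set {1..CARD('n)})"
      unfolding spectrum[symmetric] by simp
    then show ?thesis using \<theta>(2) by auto
  qed
  have "(\<Sum>i\<in>UNIV. d i) = (\<Sum>i=1..CARD('n). l i)"
    unfolding sum_unfold_sum_mset spectrum ..
  then have trace: "trace A = (\<Sum>i=1..CARD('n). l i)"
    using trace_orthogonal_diagonalization[OF P A] by simp
  let ?g = "\<lambda>z. (1 - 2 * \<theta> * z) powr (- 1 / 2)"
  have prod_eq: "(\<Prod>i\<in>UNIV. ?g (d i)) = (\<Prod>i=1..CARD('n). ?g (l i))"
    using arg_cong[OF spectrum, of "\<lambda>S. prod_mset (image_mset ?g S)"]
    by (simp add: prod_unfold_prod_mset multiset.map_comp o_def)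
  let ?Q = "\<lambda>x. x \<bullet> (A *v x)"
  let ?c = "exp (- \<theta> * (t + trace A))"
  have [measurable]: "?Q \<in> borel_measurable borel"
    by (intro borel_measurable_continuous_onI continuous_intros matrix_vector_mult_linear_continuous_on)
  have [measurable]: "X \<in> borel_measurable M"
    using distributed_measurable[OF normal] by simp
  have mgf: "(\<integral>\<^sup>+\<omega>. ennreal (exp (\<theta> * ?Q (X \<omega>))) \<partial>M) = ennreal (\<Prod>i=1..CARD('n). ?g (l i))"
  proof -
    have "(\<integral>\<^sup>+\<omega>. ennreal (exp (\<theta> * ?Q (X \<omega>))) \<partial>M)
        = (\<integral>\<^sup>+x. ennreal (mvnormal_density 0 (mat 1) x) * ennreal (exp (\<theta> * ?Q x)) \<partial>lborel)"
      by (rule distributed_nn_integral[OF normal, symmetric]) measurable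
    then show ?thesis
      using nn_integral_mvnormal_exp_diagonal_form[of P \<theta> d, OF P d]
      by (simp only: prod_eq quadratic_form_orthogonal_diagonalization[OF A])
  qed
  have "emeasure M {\<omega>\<in>space M. ?Q (X \<omega>) - trace A > t}
      \<le> emeasure M {\<omega>\<in>space M. 1 \<le> ennreal ?c * ennreal (exp (\<theta> * ?Q (X \<omega>)))}"
  proof (intro emeasure_mono subsetI CollectI conjI)
    fix \<omega> assume \<omega>: "\<omega> \<in> {\<omega>\<in>space M. ?Q (X \<omega>) - trace A > t}"
    then show "\<omega> \<in> space M" by simp
    have "0 \<le> - \<theta> * (t + trace A) + \<theta> * ?Q (X \<omega>)"
      using \<omega> \<theta>(1) mult_left_mono[of "t + trace A" "?Q (X \<omega>)" \<theta>] by simp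
    then show "1 \<le> ennreal ?c * ennreal (exp (\<theta> * ?Q (X \<omega>)))"
      by (simp add: ennreal_mult[symmetric] exp_add[symmetric])
  qed measurable
  also have "\<dots> \<le> ennreal ?c * (\<integral>\<^sup>+\<omega>. ennreal (exp (\<theta> * ?Q (X \<omega>))) * indicator (space M) \<omega> \<partial>M)"
    by (rule nn_integral_Markov_inequality) measurable
  also have "(\<integral>\<^sup>+\<omega>. ennreal (exp (\<theta> * ?Q (X \<omega>))) * indicator (space M) \<omega> \<partial>M)
      = ennreal (\<Prod>i=1..CARD('n). ?g (l i))"
    unfolding mgf[symmetric] by (intro nn_integral_cong) simp
  finally have "emeasure M {\<omega>\<in>space M. ?Q (X \<omega>) - trace A > t} \<le> ennreal (?c * (\<Prod>i=1..CARD('n). ?g (l i)))"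
    by (simp add: ennreal_mult prod_nonneg)
  then have "\<P>(\<omega> in M. ?Q (X \<omega>) - trace A > t) \<le> ?c * (\<Prod>i=1..CARD('n). ?g (l i))"
    by (simp add: emeasure_eq_measure prod_nonneg)
  also have "?c = exp (- \<theta> * t) * (\<Prod>i=1..CARD('n). exp (- \<theta> * l i))"
    by (simp only: trace distrib_left exp_add sum_distrib_left exp_sum finite_atLeastAtMost)
  finally show ?thesis
    by (simp add: prod.distrib mult.assoc)
qed

theorem proposition9:
  fixes A :: "real ^ 'n ^ 'n"
    and l :: "nat \<Rightarrow> real"
    and k :: nat
    and a b t :: real
    and M :: "'w measure"
    and X :: "'w \<Rightarrow> real ^ 'n"
    and \<Delta> :: "'w \<Rightarrow> real"
  assumes sym: "transpose A = A"
    and eig: "eigenvalues_of A l"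
    and k: "1 \<le> k" "k \<le> CARD('n) - 1"
    and sorted: "mono_on {1..k} l"
    and neg: "l k < 0"
    and smallest: "\<forall>i\<in>{k+1..CARD('n)}. l k \<le> l i"
    and a_eq: "a = Max ((\<lambda>i. \<bar>l i\<bar>) ` {k+1..CARD('n)})"
    and b_eq: "b = (\<Sum>i=1..k. l i)"
    and a_pos: "a > 0"
    and prob: "prob_space M"
    and normal: "distributed M lborel X (mvnormal_density 0 (mat 1))"
    and \<Delta>_eq: "\<And>\<omega>. \<Delta> \<omega> = X \<omega> \<bullet> (A *v X \<omega>) - trace A"
    and t_pos: "t > 0"
    and t_large: "t + b \<ge> (\<Sum>i=k+1..CARD('n). (l i)\<^sup>2) / a"
  shows "\<P>(\<omega> in M. \<Delta> \<omega> > t)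
    \<le> exp (- (kappa * (t + b) / a)) * (\<Prod>i=1..k. (2 * kappa * (- l i / a) + 1) powr (- 1 / 2))"
proof -
  define \<theta> where "\<theta> = b_star / (2 * a)"
  let ?n = "CARD('n)"
  let ?F = "\<lambda>i. exp (- \<theta> * l i) * (1 - 2 * \<theta> * l i) powr (- 1 / 2)"
  let ?G = "\<lambda>i. (2 * kappa * (- l i / a) + 1) powr (- 1 / 2)"
  have \<theta>: "\<theta> > 0" using a_pos b_star by (simp add: \<theta>_def)
  have low: "l i < 0" if "i \<in> {1..k}" for i
    using mono_onD[OF sorted that, of k] that neg k by simp
  have high: "2 * \<theta> * l i \<le> b_star" if "i \<in> {k+1..?n}" for i
  proof -
    have "\<bar>l i\<bar> \<le> a" unfolding a_eq using that by (intro Max_ge) auto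
    then have "b_star * l i \<le> b_star * a" using b_star by (intro mult_left_mono) auto
    then show ?thesis using a_pos by (simp add: \<theta>_def divide_le_eq)
  qed
  have split: "{1..?n} = {1..k} \<union> {k+1..?n}" "{1..k} \<inter> {k+1..?n} = {}"
    using k by auto
  have below_one: "2 * \<theta> * l i < 1" if "i \<in> {1..?n}" for i
  proof (cases "i \<le> k")
    case True
    then have "2 * \<theta> * l i < 0"
      using low[of i] that \<theta> by (simp add: mult_pos_neg)
    then show ?thesis by simp
  next
    case False
    then show ?thesis using high[of i] that b_star by simp
  qed
  have "\<P>(\<omega> in M. \<Delta> \<omega> > t) \<le> exp (- \<theta> * t) * (\<Prod>i=1..?n. ?F i)"
    unfolding \<Delta>_eq using mvnormal_quadratic_form_Chernoff[OF sym eig prob normal _ below_one] \<theta> by simp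
  also have "(\<Prod>i=1..?n. ?F i) = (\<Prod>i=1..k. ?F i) * (\<Prod>i=k+1..?n. ?F i)"
    using split by (simp add: prod.union_disjoint)
  also have "exp (- \<theta> * t) * \<dots> \<le> exp (- \<theta> * t) * ((exp (- \<theta> * b) * (\<Prod>i=1..k. ?G i)) *
      exp (b_star / (4 * a) * ((\<Sum>i=k+1..?n. (l i)\<^sup>2) / a)))"
  proof (intro mult_left_mono mult_mono)
    have "(\<Prod>i=1..k. ?F i) \<le> (\<Prod>i=1..k. exp (- \<theta> * l i) * ?G i)"
    proof (intro prod_mono conjI mult_left_mono)
      fix i assume i: "i \<in> {1..k}"
      \<comment> \<open>In terms of \<open>r\<close> the two bases are \<open>1 + r / 2\<close> and \<open>1 + r\<close>.\<close>
      define r where "r = b_star * (- l i / a)"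
      have "0 \<le> r"
        unfolding r_def using low[OF i] a_pos b_star(1) by (intro mult_nonneg_nonneg divide_nonneg_pos) auto
      moreover have "2 * kappa * (- l i / a) = r / 2" "- (2 * \<theta> * l i) = r"
        by (simp_all add: r_def kappa_def \<theta>_def)
      ultimately have "0 < 2 * kappa * (- l i / a) + 1" "2 * kappa * (- l i / a) + 1 \<le> 1 - 2 * \<theta> * l i"
        by linarith+
      then show "(1 - 2 * \<theta> * l i) powr (- 1 / 2) \<le> ?G i"
        by (intro powr_mono2') auto
    qed auto
    also have "\<dots> = exp (- \<theta> * b) * (\<Prod>i=1..k. ?G i)"
      by (simp add: prod.distrib b_eq sum_distrib_left exp_sum flip: sum_negf)
    finally show "(\<Prod>i=1..k. ?F i) \<le> exp (- \<theta> * b) * (\<Prod>i=1..k. ?G i)" .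
    have "(\<Prod>i=k+1..?n. ?F i) \<le> (\<Prod>i=k+1..?n. exp (b_star / (4 * a) * ((l i)\<^sup>2 / a)))"
    proof (intro prod_mono conjI)
      fix i assume i: "i \<in> {k+1..?n}"
      have "(2 * \<theta> * l i)\<^sup>2 / (4 * b_star) = b_star / (4 * a) * ((l i)\<^sup>2 / a)"
        using b_star(1) a_pos by (simp add: \<theta>_def field_simps power2_eq_square)
      then show "?F i \<le> exp (b_star / (4 * a) * ((l i)\<^sup>2 / a))"
        using centred_square_mgf_factor_le[OF high[OF i]] by simp
    qed auto
    then show "(\<Prod>i=k+1..?n. ?F i) \<le> exp (b_star / (4 * a) * ((\<Sum>i=k+1..?n. (l i)\<^sup>2) / a))"
      by (simp add: sum_divide_distrib sum_distrib_left exp_sum)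
  qed (auto intro!: prod_nonneg mult_nonneg_nonneg)
  also have "\<dots> = exp (b_star / (4 * a) * ((\<Sum>i=k+1..?n. (l i)\<^sup>2) / a) - \<theta> * (t + b)) * (\<Prod>i=1..k. ?G i)"
    by (simp add: exp_diff exp_minus exp_add distrib_left field_simps)
  also have "\<dots> \<le> exp (- (kappa * (t + b) / a)) * (\<Prod>i=1..k. ?G i)"
  proof (intro mult_right_mono prod_nonneg)
    have "b_star / (4 * a) * ((\<Sum>i=k+1..?n. (l i)\<^sup>2) / a) \<le> b_star / (4 * a) * (t + b)"
      using t_large b_star a_pos by (intro mult_left_mono) auto
    also have "\<dots> = \<theta> * (t + b) - kappa * (t + b) / a"
      using a_pos by (simp add: \<theta>_def kappa_def field_simps)
    finally show "exp (b_star / (4 * a) * ((\<Sum>i=k+1..?n. (l i)\<^sup>2) / a) - \<theta> * (t + b))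
        \<le> exp (- (kappa * (t + b) / a))"
      by simp
  qed auto
  finally show ?thesis .
qed

end
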